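(* Consider the game ${\rm SCN}(5,3)$. Its P-positions (among all configurations that can arise, i.e. circular arrangements of at most $5$ piles with positive pile sizes) are exactly the following: (1) the terminal configuration $()$; (2) $(a,a,a,a)$ with $a\ge 1$; (3) $(1,M,a,b,M)$ with integers $1\le a<b\le M$ and $1+M=a+b$; (4) $(2,2p,p+1,p,2p-1)$ with an integer $p\ge 2$.
   Context: Shrinking Circular Nim ${\rm SCN}(n,k)$, for positive integers $k\le n$: initially $n$ piles of stones are arranged on a circle. Two players alternate turns. On a turn, a player selects $k$ consecutive (cyclically adjacent) piles among the currently remaining piles and removes any number of stones from each of them, removing at least one stone in total (some of the selected piles may be left untouched). Whenever a pile becomes empty it vanishes and the circle closes up: the remaining piles keep their cyclic order and the neighbours of the vanished pile become adjacent. If at most $k$ piles remain, a move may remove stones from any of the remaining piles (all of them may be selected). The player who removes the last stone wins (a player with no move loses). A configuration is written as the tuple $(x_1,\dots,x_r)$ of the positive pile sizes in cyclic order; tuples that agree up to rotation or reflection denote the same configuration, and $()$ denotes the empty (terminal) configuration. A P-position is a configuration from which the player to move loses under optimal play by the opponent. *)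

theory Defs
  imports Main
begin

text \<open>
  Shrinking Circular Nim: a configuration of at most \<open>n\<close> piles is represented by the list of its
  (positive) pile sizes in cyclic order.
\<close>

definition scn_configs :: "nat \<Rightarrow> nat list set" where
  "scn_configs n = {xs. length xs \<le> n \<and> (\<forall>x\<in>set xs. 0 < x)}"

text \<open>Two tuples denote the same circular configuration iff they agree up to rotation or reflection.\<close>

definition same_config :: "nat list \<Rightarrow> nat list \<Rightarrow> bool" where
  "same_config xs ys \<longleftrightarrow> (\<exists>m. ys = rotate m xs \<or> ys = rotate m (rev xs))"

text \<open>
  The indices of \<open>k\<close> cyclically consecutive piles among \<open>r\<close> piles, starting at \<open>s\<close>.
  If \<open>r \<le> k\<close>, these are all the piles.
\<close>

definition arc :: "nat \<Rightarrow> nat \<Rightarrow> nat \<Rightarrow> nat set" where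
  "arc r k s = {(s + i) mod r | i. i < k}"

text \<open>
  In a move, \<open>zs\<close> lists the pile sizes after the removal of stones, with emptied piles still
  present as zeros; the filter then closes up the circle.  Since \<open>zs \<noteq> xs\<close>, at least one stone is
  removed.
\<close>

definition scn_move :: "nat \<Rightarrow> nat list \<Rightarrow> nat list \<Rightarrow> bool" where
  "scn_move k xs ys \<longleftrightarrow>
     (\<exists>s zs. s < length xs \<and> length zs = length xs \<and>
        (\<forall>j<length xs. zs ! j \<le> xs ! j) \<and>
        (\<forall>j<length xs. j \<notin> arc (length xs) k s \<longrightarrow> zs ! j = xs ! j) \<and>
        zs \<noteq> xs \<and> ys = filter (\<lambda>z. 0 < z) zs)"

text \<open>
  Outcome classes under normal play: the player to move loses (\<open>scn_losing\<close>) or wins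
  (\<open>scn_winning\<close>) under optimal play.  Every move decreases the number of stones, so
  the game terminates and the least fixed point assigns an outcome to every configuration.
\<close>

inductive scn_losing :: "nat \<Rightarrow> nat list \<Rightarrow> bool"
  and scn_winning :: "nat \<Rightarrow> nat list \<Rightarrow> bool"
  for k :: nat
where
  losingI: "(\<And>ys. scn_move k xs ys \<Longrightarrow> scn_winning k ys) \<Longrightarrow> scn_losing k xs"
| winningI: "scn_move k xs ys \<Longrightarrow> scn_losing k ys \<Longrightarrow> scn_winning k xs"

definition scn_P_positions :: "nat \<Rightarrow> nat \<Rightarrow> nat list set" where
  "scn_P_positions n k = {xs \<in> scn_configs n. scn_losing k xs}"

end

theory Submission
  imports Defs
begin

text \<open>
  The listed positions are a kernel of the move graph: no move joins two of them, and every other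
  configuration has a move into them.  For five piles, all at least 2, look at three largest piles.
  If they are consecutive, the four piles going from the first to the last of them the long way
  round are \<open>M, a, b, M'\<close> with \<open>a, b \<le> M \<le> M'\<close> up to reflection, and the fifth pile
  can be lowered to 0, 1 or 2; otherwise one of the three is isolated from the other two, and either
  it is kept together with one of its neighbours or the three are equal and all kept.  Positions with a pile of size 1 are treated directly.
\<close>

section \<open>Kernels of the move graph\<close>

lemma scn_losing_winning_disjoint:
  "(scn_losing k xs \<longrightarrow> \<not> scn_winning k xs) \<and> (scn_winning k xs \<longrightarrow> \<not> scn_losing k xs)"
proof -
  \<comment> \<open>The simultaneous induction rule has a separate variable for each of the two
    judgements; \<open>xs\<close> and \<open>ys\<close> are identified afterwards.\<close>
  have "(scn_losing k xs \<longrightarrow> \<not> scn_winning k xs) \<and> (scn_winning k ys \<longrightarrow> \<not> scn_losing k ys)" for xs ys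
  proof (rule scn_losing_scn_winning.induct)
    fix xs assume "\<And>ys. scn_move k xs ys \<Longrightarrow> scn_winning k ys"
      "\<And>ys. scn_move k xs ys \<Longrightarrow> \<not> scn_losing k ys"
    then show "\<not> scn_winning k xs" by (auto elim: scn_winning.cases)
  next
    fix xs ys assume "scn_move k xs ys" "scn_losing k ys" "\<not> scn_winning k ys"
    then show "\<not> scn_losing k xs" by (auto elim: scn_losing.cases)
  qed
  then show ?thesis by blast
qed

lemma sum_list_filter_pos: "sum_list (filter (\<lambda>z. 0 < z) zs) = sum_list (zs :: nat list)"
  by (induction zs) auto

lemma scn_move_sum_list:
  assumes "scn_move k xs ys"
  shows "sum_list ys < sum_list xs"
proof -
  obtain zs where zs: "length zs = length xs" "\<forall>j<length xs. zs ! j \<le> xs ! j" "zs \<noteq> xs"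
    "ys = filter (\<lambda>z. 0 < z) zs"
    using assms unfolding scn_move_def by blast
  then obtain j where "j < length xs" "zs ! j < xs ! j"
    by (metis le_neq_implies_less nth_equalityI)
  then have "(\<Sum>i<length xs. zs ! i) < (\<Sum>i<length xs. xs ! i)"
    using zs(2) by (intro sum_strict_mono_ex1) auto
  then have "sum_list zs < sum_list xs"
    using zs(1) by (simp add: sum_list_sum_nth atLeast0LessThan)
  then show ?thesis
    by (simp add: zs(4) sum_list_filter_pos)
qed

lemma scn_move_configs:
  assumes "scn_move k xs ys" "xs \<in> scn_configs n"
  shows "ys \<in> scn_configs n"
  using assms unfolding scn_move_def scn_configs_def
  by (auto intro: order_trans[OF length_filter_le])

text \<open>Strong induction on the number of stones: moves from \<open>K\<close> lead only to
  winning positions, and positions outside \<open>K\<close> have a move to a losing one. As the two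
  outcomes exclude each other, nothing outside \<open>K\<close> is losing.\<close>

lemma scn_P_positions_kernel:
  assumes sub: "K \<subseteq> scn_configs n"
    and stable: "\<And>xs ys. xs \<in> K \<Longrightarrow> scn_move k xs ys \<Longrightarrow> ys \<notin> K"
    and absorb: "\<And>xs. xs \<in> scn_configs n \<Longrightarrow> xs \<notin> K \<Longrightarrow> \<exists>ys\<in>K. scn_move k xs ys"
  shows "scn_P_positions n k = K"
proof -
  have "(xs \<in> K \<longrightarrow> scn_losing k xs) \<and> (xs \<notin> K \<longrightarrow> scn_winning k xs)"
    if "xs \<in> scn_configs n" for xs
    using that
  proof (induction "sum_list xs" arbitrary: xs rule: less_induct)
    case less
    have IH: "(ys \<in> K \<longrightarrow> scn_losing k ys) \<and> (ys \<notin> K \<longrightarrow> scn_winning k ys)"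
      if "scn_move k xs ys" for ys
      using less.hyps[OF scn_move_sum_list[OF that] scn_move_configs[OF that less.prems]] .
    show ?case
      using IH stable absorb[OF less.prems] by (meson losingI winningI)
  qed
  then show ?thesis
    using sub scn_losing_winning_disjoint unfolding scn_P_positions_def by blast
qed

section \<open>Circular arrangements of five numbers\<close>

text \<open>The orbit under the dihedral group of order 10, phrased for predicates on five numbers
  instead of lists, so that case analysis ends in linear arithmetic.\<close>

definition dihedral5 ::
  "(nat \<Rightarrow> nat \<Rightarrow> nat \<Rightarrow> nat \<Rightarrow> nat \<Rightarrow> bool) \<Rightarrow> nat \<Rightarrow> nat \<Rightarrow> nat \<Rightarrow> nat \<Rightarrow> nat \<Rightarrow> bool" where
  "dihedral5 R v w x y z \<longleftrightarrow>
     R v w x y z \<or> R w x y z v \<or> R x y z v w \<or> R y z v w x \<or> R z v w x y \<or>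
     R z y x w v \<or> R y x w v z \<or> R x w v z y \<or> R w v z y x \<or> R v z y x w"

lemma dihedral5_rotate: "dihedral5 R w x y z v = dihedral5 R v w x y z"
  by (auto simp: dihedral5_def)

lemma dihedral5_rev: "dihedral5 R z y x w v = dihedral5 R v w x y z"
  by (auto simp: dihedral5_def)

lemma same_config_conv:
  "xs \<noteq> [] \<Longrightarrow> same_config xs ys \<longleftrightarrow>
     (\<exists>m<length xs. ys = rotate m xs \<or> ys = rotate m (rev xs))"
  unfolding same_config_def
  by (metis length_rev length_greater_0_conv mod_less_divisor rotate_conv_mod)

lemma same_config_five:
  "same_config [v, w, x, y, z] ys \<longleftrightarrow>
     ys = [v, w, x, y, z] \<or> ys = [w, x, y, z, v] \<or> ys = [x, y, z, v, w] \<or>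
     ys = [y, z, v, w, x] \<or> ys = [z, v, w, x, y] \<or>
     ys = [z, y, x, w, v] \<or> ys = [y, x, w, v, z] \<or> ys = [x, w, v, z, y] \<or>
     ys = [w, v, z, y, x] \<or> ys = [v, z, y, x, w]"
proof -
  have less_five: "(\<exists>m<length [v, w, x, y, z]. P m) \<longleftrightarrow> P 0 \<or> P 1 \<or> P 2 \<or> P 3 \<or> P 4" for P
    by (auto simp: eval_nat_numeral less_Suc_eq)
  have "same_config [v, w, x, y, z] ys \<longleftrightarrow>
     (ys = [v, w, x, y, z] \<or> ys = [z, y, x, w, v]) \<or>
     (ys = [w, x, y, z, v] \<or> ys = [y, x, w, v, z]) \<or>
     (ys = [x, y, z, v, w] \<or> ys = [x, w, v, z, y]) \<or>
     (ys = [y, z, v, w, x] \<or> ys = [w, v, z, y, x]) \<or>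
     (ys = [z, v, w, x, y] \<or> ys = [v, z, y, x, w])"
    unfolding same_config_conv[OF list.simps(3)] less_five by (simp add: rotate_drop_take)
  then show ?thesis by (elim ssubst) (rule iffI; elim disjE; simp)
qed

text \<open>Bridge from tuples up to rotation and reflection to the arithmetic form: only ten lists
  are candidates for \<open>ys\<close>.\<close>

lemma same_config5:
  "(\<exists>ys. same_config [v, w, x, y, z] ys \<and> (\<exists>a b c d e. ys = [a, b, c, d, e] \<and> R a b c d e))
    \<longleftrightarrow> dihedral5 R v w x y z"
  unfolding same_config_five dihedral5_def conj_disj_distribR ex_disj_distrib by simp

lemma same_config_refl: "same_config xs xs"
  unfolding same_config_def by (rule exI[of _ 0]) simp

text \<open>
  A pile emptied by a move is kept as a 0 here, so that \<open>four\<close> is the family (2) and all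
  moves from five piles lead to five numbers.
\<close>

definition four :: "nat \<Rightarrow> nat \<Rightarrow> nat \<Rightarrow> nat \<Rightarrow> nat \<Rightarrow> bool" where
  "four v w x y z \<longleftrightarrow> v = 0 \<and> 0 < w \<and> x = w \<and> y = w \<and> z = w"

definition one_family :: "nat \<Rightarrow> nat \<Rightarrow> nat \<Rightarrow> nat \<Rightarrow> nat \<Rightarrow> bool" where
  "one_family v w x y z \<longleftrightarrow> v = 1 \<and> z = w \<and> 1 \<le> x \<and> x < y \<and> y \<le> w \<and> 1 + w = x + y"

text \<open>The parameter p is the entry \<open>y\<close>; \<open>z + 1 = 2 * y\<close> expresses z
  = 2p - 1 without truncated subtraction.\<close>

definition two_family :: "nat \<Rightarrow> nat \<Rightarrow> nat \<Rightarrow> nat \<Rightarrow> nat \<Rightarrow> bool" where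
  "two_family v w x y z \<longleftrightarrow> 2 \<le> y \<and> v = 2 \<and> w = 2 * y \<and> x = y + 1 \<and> z + 1 = 2 * y"

text \<open>The empty configuration is absent: a move from five positive piles keeps two of them and
  cannot end there.\<close>

definition kernel5 :: "nat \<Rightarrow> nat \<Rightarrow> nat \<Rightarrow> nat \<Rightarrow> nat \<Rightarrow> bool" where
  "kernel5 = dihedral5 (\<lambda>v w x y z. four v w x y z \<or> one_family v w x y z \<or> two_family v w x y z)"

lemma kernel5_rotate: "kernel5 w x y z v = kernel5 v w x y z"
  by (simp add: kernel5_def dihedral5_rotate)

lemma kernel5_rev: "kernel5 z y x w v = kernel5 v w x y z"
  by (simp add: kernel5_def dihedral5_rev[of _ v])

lemma kernel5_four: "0 < a \<Longrightarrow> kernel5 0 a a a a"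
  by (simp add: kernel5_def dihedral5_def four_def)

text \<open>Reflection swaps \<open>a\<close> and \<open>b\<close>, so distinctness can replace the
  order a < b; each is at most M because the other is at least 1.\<close>

lemma kernel5_one:
  assumes "1 \<le> a" "1 \<le> b" "a \<noteq> b" "1 + M = a + b"
  shows "kernel5 1 M a b M"
proof -
  have "one_family 1 M a b M \<or> one_family 1 M b a M"
    using assms unfolding one_family_def by linarith
  then show ?thesis unfolding kernel5_def dihedral5_def by blast
qed

lemma kernel5_two: "2 \<le> p \<Longrightarrow> kernel5 2 (2 * p) (p + 1) p (2 * p - 1)"
  by (simp add: kernel5_def dihedral5_def two_family_def)

definition move5 ::
  "nat \<Rightarrow> nat \<Rightarrow> nat \<Rightarrow> nat \<Rightarrow> nat \<Rightarrow> nat \<Rightarrow> nat \<Rightarrow> nat \<Rightarrow> nat \<Rightarrow> nat \<Rightarrow> bool" where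
  "move5 v w x y z v' w' x' y' z' \<longleftrightarrow>
     v' \<le> v \<and> w' \<le> w \<and> x' \<le> x \<and> y' \<le> y \<and> z' \<le> z \<and>
     (v' = v \<and> w' = w \<or> w' = w \<and> x' = x \<or> x' = x \<and> y' = y \<or> y' = y \<and> z' = z \<or> z' = z \<and> v' = v)"

lemma move5_rotate: "move5 w x y z v w' x' y' z' v' = move5 v w x y z v' w' x' y' z'"
  unfolding move5_def by blast

lemma move5_rev: "move5 z y x w v z' y' x' w' v' = move5 v w x y z v' w' x' y' z'"
  unfolding move5_def by blast

section \<open>No move inside the kernel\<close>

text \<open>Each choice of kept pair, target family and placement of that family leaves a linear
  system that is contradictory or forces all entries to agree.\<close>

lemma one_family_stable:
  assumes "one_family v w x y z" "move5 v w x y z v' w' x' y' z'" "kernel5 v' w' x' y' z'"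
  shows "v' = v \<and> w' = w \<and> x' = x \<and> y' = y \<and> z' = z"
  using assms
  unfolding kernel5_def dihedral5_def move5_def four_def one_family_def two_family_def
  by (elim disjE conjE) linarith+

lemma two_family_stable:
  assumes "two_family v w x y z" "move5 v w x y z v' w' x' y' z'" "kernel5 v' w' x' y' z'"
  shows "v' = v \<and> w' = w \<and> x' = x \<and> y' = y \<and> z' = z"
  using assms
  unfolding kernel5_def dihedral5_def move5_def four_def one_family_def two_family_def
  by (elim disjE conjE) linarith+

text \<open>Having five arguments, it fits \<open>dihedral5\<close>; rotation and reflection then
  reduce stability to the standard orientation of each family.\<close>

definition stable5 :: "nat \<Rightarrow> nat \<Rightarrow> nat \<Rightarrow> nat \<Rightarrow> nat \<Rightarrow> bool" where
  "stable5 v w x y z \<longleftrightarrow> (\<forall>v' w' x' y' z'. move5 v w x y z v' w' x' y' z' \<longrightarrow>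
     kernel5 v' w' x' y' z' \<longrightarrow> v' = v \<and> w' = w \<and> x' = x \<and> y' = y \<and> z' = z)"

lemma stable5_rotate:
  assumes "stable5 v w x y z"
  shows "stable5 w x y z v"
  unfolding stable5_def
proof (intro allI impI)
  fix w' x' y' z' v'
  assume mv: "move5 w x y z v w' x' y' z' v'" and ker: "kernel5 w' x' y' z' v'"
  from mv[THEN move5_rotate[THEN iffD1]] ker[THEN kernel5_rotate[THEN iffD1]]
  show "w' = w \<and> x' = x \<and> y' = y \<and> z' = z \<and> v' = v"
    using assms unfolding stable5_def by blast
qed

lemma stable5_rev:
  assumes "stable5 v w x y z"
  shows "stable5 z y x w v"
  unfolding stable5_def
proof (intro allI impI)
  fix z' y' x' w' v'
  assume mv: "move5 z y x w v z' y' x' w' v'" and ker: "kernel5 z' y' x' w' v'"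
  from mv[THEN move5_rev[THEN iffD1]] ker[THEN kernel5_rev[THEN iffD1]]
  show "z' = z \<and> y' = y \<and> x' = x \<and> w' = w \<and> v' = v"
    using assms unfolding stable5_def by blast
qed

lemma stable5_kernel5:
  assumes ker: "kernel5 v w x y z" and pos: "0 < v" "0 < w" "0 < x" "0 < y" "0 < z"
  shows "stable5 v w x y z"
proof -
  have st: "stable5 p q r s t" if "one_family p q r s t \<or> two_family p q r s t" for p q r s t
    using that one_family_stable two_family_stable unfolding stable5_def by blast
  have "dihedral5 (\<lambda>v w x y z. one_family v w x y z \<or> two_family v w x y z) v w x y z"
    using ker pos unfolding kernel5_def dihedral5_def four_def by auto
  then have "dihedral5 stable5 v w x y z"
    using st unfolding dihedral5_def by blast
  then show ?thesis
    unfolding dihedral5_def by (elim disjE) (blast intro: stable5_rotate stable5_rev)+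
qed

section \<open>Reaching the kernel\<close>

definition reach5 :: "nat \<Rightarrow> nat \<Rightarrow> nat \<Rightarrow> nat \<Rightarrow> nat \<Rightarrow> bool" where
  "reach5 v w x y z \<longleftrightarrow> (\<exists>v' w' x' y' z'. move5 v w x y z v' w' x' y' z' \<and> kernel5 v' w' x' y' z')"

lemma reach5I: "kernel5 v' w' x' y' z' \<Longrightarrow> move5 v w x y z v' w' x' y' z' \<Longrightarrow> reach5 v w x y z"
  unfolding reach5_def by blast

lemma reach5_rotate: "reach5 v w x y z \<Longrightarrow> reach5 w x y z v"
  unfolding reach5_def using move5_rotate[THEN iffD2] kernel5_rotate[THEN iffD2] by blast

lemma reach5_rev: "reach5 v w x y z \<Longrightarrow> reach5 z y x w v"
  unfolding reach5_def using move5_rev[THEN iffD2] kernel5_rev[THEN iffD2] by blast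

section \<open>Five piles, one of them of size 1\<close>

lemma reach5_with_one_le:
  assumes pos: "0 < L" "0 < c" "0 < d" "0 < R" and le: "L \<le> R"
  shows "reach5 1 L c d R"
proof (cases "L = 1")
  case True
  have "kernel5 1 1 1 1 0"
    using kernel5_four[of 1] by (simp add: kernel5_rotate)
  then show ?thesis
    using True pos by (intro reach5I) (auto simp: move5_def)
next
  case L: False
  \<comment> \<open>Keep the adjacent piles 1 and \<open>L\<close>, lower \<open>R\<close> to
    \<open>L\<close>, and lower \<open>c\<close>, \<open>d\<close> to unequal numbers with sum L +
    1.\<close>
  have via_one: "reach5 1 L c d R"
    if "1 \<le> a" "1 \<le> b" "a \<noteq> b" "1 + L = a + b" "a \<le> c" "b \<le> d" for a b
    using that le by (intro reach5I[OF kernel5_one[of a b L]]) (auto simp: move5_def)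
  consider (eq) "c = d" "c \<le> L" | (eq_gt) "c = d" "L < c" | (small) "c \<noteq> d" "c + d \<le> L + 1"
    | (big) "c \<noteq> d" "L + 1 < c + d"
    by linarith
  then show ?thesis
  proof cases
    case eq
    then show ?thesis
      using pos le by (intro reach5I[OF kernel5_four[of c]]) (auto simp: move5_def)
  next
    case eq_gt
    then show ?thesis using L pos by (intro via_one[of 1 L]) auto
  next
    case small
    then show ?thesis
      using pos le by (intro reach5I[OF kernel5_one[of c d "c + d - 1"]]) (auto simp: move5_def)
  next
    case big
    \<comment> \<open>The choice a = c, b = L + 1 - c breaks down only if c is too large or if it
      gives a = b. In the latter case d > c, so shifting to c - 1 and c + 1 is possible.\<close>
    consider "L \<le> c" | "c < L" "2 * c \<noteq> L + 1" | "2 * c = L + 1"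
      by linarith
    then show ?thesis
    proof cases
      case 1
      then show ?thesis using L pos by (intro via_one[of L 1]) auto
    next
      case 2
      then show ?thesis using big pos by (intro via_one[of c "L + 1 - c"]) auto
    next
      case 3
      then show ?thesis using big pos L by (intro via_one[of "c - 1" "c + 1"]) auto
    qed
  qed
qed

lemma reach5_with_one:
  assumes "0 < L" "0 < c" "0 < d" "0 < R"
  shows "reach5 1 L c d R"
proof (cases "L \<le> R")
  case False
  then have "reach5 1 R d c L" using assms by (intro reach5_with_one_le) auto
  then show ?thesis by (blast intro: reach5_rotate reach5_rev)
qed (use assms reach5_with_one_le in blast)

section \<open>Five piles, all of size at least 2\<close>

text \<open>The pile \<open>e\<close> becomes the special entry of the target: 0 for
  \<open>four\<close>, 1 for \<open>one_family\<close>, 2 for \<open>two_family\<close>.\<close>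

lemma reach5_path_le:
  assumes two: "2 \<le> M" "2 \<le> a" "2 \<le> b" "2 \<le> M'" "2 \<le> e"
    and le: "a \<le> M" "b \<le> M" "M \<le> M'"
  shows "reach5 M a b M' e"
proof -
  have via_one: "reach5 M a b M' e"
    if "1 \<le> a'" "1 \<le> b'" "a' \<noteq> b'" "1 + N = a' + b'" "move5 M a b M' e N a' b' N 1" for a' b' N
    using kernel5_one[OF that(1-4)] that(5) by (metis kernel5_rotate reach5I)
  consider (eq) "a = b" | (small) "a \<noteq> b" "a + b \<le> M" | (left) "M < a + b" "2 * a \<noteq> M + 1"
    | (right) "M < a + b" "a \<noteq> b" "2 * a = M + 1" "M' = M"
    | (two) "M < a + b" "a \<noteq> b" "2 * a = M + 1" "M < M'"
    using le by linarith
  then show ?thesis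
  proof cases
    case eq
    have "kernel5 a a a a 0"
      using kernel5_four[of a] two by (simp add: kernel5_rotate)
    then show ?thesis using eq le by (intro reach5I) (auto simp: move5_def)
  next
    case small
    then show ?thesis
      using two le by (intro via_one[of a b "a + b - 1"]) (auto simp: move5_def)
  next
    case left
    then show ?thesis
      using two le by (intro via_one[of a "M + 1 - a" M]) (auto simp: move5_def)
  next
    \<comment> \<open>Keeping \<open>M\<close> and \<open>a\<close> would lower \<open>b\<close> to
      \<open>a\<close>, which is forbidden. Since M' = M, the pair \<open>b\<close>,
      \<open>M'\<close> can be kept instead.\<close>
    case right
    then show ?thesis
      using two le by (intro via_one[of "M + 1 - b" b M]) (auto simp: move5_def)
  next
    \<comment> \<open>Here M = 2a - 1, hence b > a, and M' is at least 2a: \<open>M\<close> and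
      \<open>a\<close> are kept as the entries 2p - 1 and p with p = a.\<close>
    case two
    have "kernel5 (2 * a - 1) a (a + 1) (2 * a) 2"
      using kernel5_two[OF \<open>2 \<le> a\<close>] by (metis kernel5_rev)
    then show ?thesis
      using two le assms by (intro reach5I) (auto simp: move5_def)
  qed
qed

lemma reach5_path:
  assumes "2 \<le> M" "2 \<le> a" "2 \<le> b" "2 \<le> M'" "2 \<le> e"
    and "a \<le> M" "b \<le> M" "a \<le> M'" "b \<le> M'"
  shows "reach5 M a b M' e"
proof (cases "M \<le> M'")
  case False
  then have "reach5 M' b a M e" using assms by (intro reach5_path_le) auto
  then show ?thesis by (blast intro: reach5_rotate reach5_rev)
qed (use assms reach5_path_le in blast)

text \<open>Keeping \<open>M\<close> and \<open>c\<close> needs a partner M + 1 - c different from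
  \<open>c\<close>, and likewise for \<open>d\<close>. If both fail, c = d and M = 2c - 1; then an
  excess of \<open>s\<close> or \<open>t\<close> over \<open>M\<close> leaves room for the entry 2c
  of \<open>two_family\<close>, and otherwise s = t = M.\<close>

lemma reach5_isolated:
  assumes two: "2 \<le> s" "2 \<le> t" "2 \<le> c" "2 \<le> M" "2 \<le> d"
    and le: "M \<le> s" "M \<le> t" "c \<le> M" "d \<le> M"
  shows "reach5 s t c M d"
proof -
  consider (left) "2 * c \<noteq> M + 1" | (right) "2 * d \<noteq> M + 1"
    | (two_s) "2 * c = M + 1" "d = c" "M < s" | (two_t) "2 * c = M + 1" "d = c" "M < t"
    | (eq) "s = M" "t = M"
    using le by linarith
  then show ?thesis
  proof cases
    case left
    have "kernel5 1 M (M + 1 - c) c M"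
      using left two le by (intro kernel5_one) auto
    then have "kernel5 M (M + 1 - c) c M 1" by (metis kernel5_rotate)
    then show ?thesis using two le by (intro reach5I) (auto simp: move5_def)
  next
    case right
    have "kernel5 1 M d (M + 1 - d) M"
      using right two le by (intro kernel5_one) auto
    then have "kernel5 (M + 1 - d) M 1 M d" by (metis kernel5_rotate)
    then show ?thesis using two le by (intro reach5I) (auto simp: move5_def)
  next
    case two_s
    have "kernel5 (2 * c) (c + 1) c (2 * c - 1) 2"
      using kernel5_two[of c] two by (metis kernel5_rotate)
    then show ?thesis using two_s two le by (intro reach5I) (auto simp: move5_def)
  next
    case two_t
    have "kernel5 (c + 1) (2 * c) 2 (2 * c - 1) c"
      using kernel5_two[of c] two by (metis kernel5_rotate kernel5_rev)
    then show ?thesis using two_t two le by (intro reach5I) (auto simp: move5_def)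
  next
    case eq
    have "kernel5 1 M 1 M M"
      using two by (intro kernel5_one) auto
    then have "kernel5 M M 1 M 1" by (metis kernel5_rotate)
    then show ?thesis using eq two by (intro reach5I) (auto simp: move5_def)
  qed
qed

lemma reach5_max:
  assumes two: "2 \<le> v" "2 \<le> w" "2 \<le> x" "2 \<le> y" "2 \<le> z"
    and max: "w \<le> v" "x \<le> v" "y \<le> v" "z \<le> v"
  shows "reach5 v w x y z"
proof -
  \<comment> \<open>For x at most y: if w is at most y, the first case holds; otherwise the third or
    the fifth, as z is at most y or not. Reflection gives the second, fourth and fifth
    cases.\<close>
  consider "w \<le> y" "x \<le> y" | "z \<le> x" "y \<le> x" | "y \<le> w" "x \<le> y" "z \<le> y"
    | "x \<le> z" "w \<le> x" "y \<le> x" | "x \<le> w" "y \<le> w" "x \<le> z" "y \<le> z"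
    by linarith
  then show ?thesis
  proof cases
    case 1
    then show ?thesis using two max by (intro reach5_path) auto
  next
    case 2
    then have "reach5 x y z v w" using two max by (intro reach5_path) auto
    then show ?thesis by (blast intro: reach5_rotate)
  next
    case 3
    then show ?thesis using two max by (intro reach5_isolated) auto
  next
    case 4
    then have "reach5 z v w x y" using two max by (intro reach5_isolated) auto
    then show ?thesis by (blast intro: reach5_rotate)
  next
    \<comment> \<open>Here the lowered fifth pile is the maximum \<open>v\<close> itself.\<close>
    case 5
    then have "reach5 w x y z v" using two max by (intro reach5_path) auto
    then show ?thesis by (blast intro: reach5_rotate)
  qed
qed

lemma reach5_pos:
  assumes pos: "0 < v" "0 < w" "0 < x" "0 < y" "0 < z"
  shows "reach5 v w x y z"
proof -
  have rot: "reach5 w x y z v \<Longrightarrow> ?thesis" "reach5 x y z v w \<Longrightarrow> ?thesis"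
    "reach5 y z v w x \<Longrightarrow> ?thesis" "reach5 z v w x y \<Longrightarrow> ?thesis"
    by (blast intro: reach5_rotate)+
  show ?thesis
  proof (cases "v = 1 \<or> w = 1 \<or> x = 1 \<or> y = 1 \<or> z = 1")
    case True
    then show ?thesis using reach5_with_one pos rot by blast
  next
    case False
    then have two: "2 \<le> v" "2 \<le> w" "2 \<le> x" "2 \<le> y" "2 \<le> z"
      using pos by linarith+
    have "Max {v, w, x, y, z} \<in> {v, w, x, y, z}" by (rule Max_in) auto
    moreover have le: "v \<le> Max {v, w, x, y, z}" "w \<le> Max {v, w, x, y, z}"
      "x \<le> Max {v, w, x, y, z}" "y \<le> Max {v, w, x, y, z}" "z \<le> Max {v, w, x, y, z}"
      by (rule Max_ge; simp)+
    ultimately consider "Max {v, w, x, y, z} = v" | "Max {v, w, x, y, z} = w"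
      | "Max {v, w, x, y, z} = x" | "Max {v, w, x, y, z} = y" | "Max {v, w, x, y, z} = z"
      by blast
    then show ?thesis
    proof cases
      case 1
      show ?thesis using two le unfolding 1 by (intro reach5_max)
    next
      case 2
      show ?thesis using two le unfolding 2 by (intro rot(1) reach5_max)
    next
      case 3
      show ?thesis using two le unfolding 3 by (intro rot(2) reach5_max)
    next
      case 4
      show ?thesis using two le unfolding 4 by (intro rot(3) reach5_max)
    next
      case 5
      show ?thesis using two le unfolding 5 by (intro rot(4) reach5_max)
    qed
  qed
qed

section \<open>Configurations as lists\<close>

lemma length_eq_4: "length xs = 4 \<longleftrightarrow> (\<exists>w x y z. xs = [w, x, y, z])"
  by (auto simp: eval_nat_numeral length_Suc_conv)

lemma length_eq_5: "length xs = 5 \<longleftrightarrow> (\<exists>v w x y z. xs = [v, w, x, y, z])"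
  by (auto simp: eval_nat_numeral length_Suc_conv)

lemma less_4_iff: "i < 4 \<longleftrightarrow> i = 0 \<or> i = 1 \<or> i = 2 \<or> i = (3 :: nat)"
  by linarith

lemma less_5_iff: "i < 5 \<longleftrightarrow> i = 0 \<or> i = 1 \<or> i = 2 \<or> i = 3 \<or> i = (4 :: nat)"
  by linarith

section \<open>Moves on lists of four and five piles\<close>

lemma arc_three: "arc r 3 s = {s mod r, (s + 1) mod r, (s + 2) mod r}"
proof -
  have "arc r 3 s = (\<lambda>i. (s + i) mod r) ` {..<3}"
    unfolding arc_def by (simp add: setcompr_eq_image lessThan_def)
  also have "{..<3} = {0, 1, 2 :: nat}"
    by (simp add: lessThan_nat_numeral lessThan_Suc insert_commute)
  finally show ?thesis by simp
qed

lemma arc_four: "j < 4 \<Longrightarrow> s < 4 \<Longrightarrow> j \<in> arc 4 3 s \<longleftrightarrow> j \<noteq> (s + 3) mod 4"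
  unfolding less_4_iff arc_three by (elim disjE) simp_all

lemma arc_five: "j < 5 \<Longrightarrow> s < 5 \<Longrightarrow> j \<in> arc 5 3 s \<longleftrightarrow> j \<noteq> (s + 3) mod 5 \<and> j \<noteq> (s + 4) mod 5"
  unfolding less_5_iff arc_three by (elim disjE) simp_all

text \<open>An arc of three among four piles misses just one pile, and this can be any of
  them.\<close>

lemma scn_move_four:
  "scn_move 3 [w, x, y, z] ys \<longleftrightarrow>
    (\<exists>w' x' y' z'. ys = filter (\<lambda>z. 0 < z) [w', x', y', z'] \<and> [w', x', y', z'] \<noteq> [w, x, y, z] \<and>
       w' \<le> w \<and> x' \<le> x \<and> y' \<le> y \<and> z' \<le> z \<and> (w' = w \<or> x' = x \<or> y' = y \<or> z' = z))"
  (is "_ \<longleftrightarrow> ?R")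
proof
  have len: "length [w, x, y, z] = 4" by simp
  assume "scn_move 3 [w, x, y, z] ys"
  then obtain s zs where s: "s < 4" and zs: "length zs = 4" "zs \<noteq> [w, x, y, z]"
    "ys = filter (\<lambda>z. 0 < z) zs" and le: "\<forall>j<4. zs ! j \<le> [w, x, y, z] ! j"
    and keep: "\<forall>j<4. j \<notin> arc 4 3 s \<longrightarrow> zs ! j = [w, x, y, z] ! j"
    unfolding scn_move_def len by blast
  obtain w' x' y' z' where zs_eq: "zs = [w', x', y', z']"
    using zs(1) unfolding length_eq_4 by blast
  have "w' \<le> w \<and> x' \<le> x \<and> y' \<le> y \<and> z' \<le> z"
    using le unfolding less_4_iff zs_eq by simp
  moreover have "w' = w \<or> x' = x \<or> y' = y \<or> z' = z"
    using keep[rule_format, of "(s + 3) mod 4"] s unfolding zs_eq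
    by (auto simp: arc_four less_4_iff)
  ultimately show ?R using zs zs_eq by blast
next
  have len: "length [w, x, y, z] = 4" by simp
  assume ?R
  then obtain w' x' y' z' where ys: "ys = filter (\<lambda>z. 0 < z) [w', x', y', z']"
    and ne: "[w', x', y', z'] \<noteq> [w, x, y, z]"
    and le: "w' \<le> w" "x' \<le> x" "y' \<le> y" "z' \<le> z" and "w' = w \<or> x' = x \<or> y' = y \<or> z' = z"
    by blast
  \<comment> \<open>The arc starting at \<open>s\<close> misses exactly the index (s + 3) mod 4, so
    \<open>s\<close> is the successor of a kept index.\<close>
  then have "\<exists>s\<in>{0, 1, 2, 3}. [w', x', y', z'] ! ((s + 3) mod 4) = [w, x, y, z] ! ((s + 3) mod 4)"
    by simp blast
  then obtain s where "s \<in> {0, 1, 2, 3}"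
    and s: "[w', x', y', z'] ! ((s + 3) mod 4) = [w, x, y, z] ! ((s + 3) mod 4)"
    by blast
  then have "s < 4" by auto
  have "\<forall>j<4. [w', x', y', z'] ! j \<le> [w, x, y, z] ! j"
    using le by (auto simp: less_4_iff)
  moreover have "\<forall>j<4. j \<notin> arc 4 3 s \<longrightarrow> [w', x', y', z'] ! j = [w, x, y, z] ! j"
    using s \<open>s < 4\<close> arc_four by blast
  ultimately show "scn_move 3 [w, x, y, z] ys"
    unfolding scn_move_def len using \<open>s < 4\<close> ys ne
    by (intro exI[of _ s] exI[of _ "[w', x', y', z']"] conjI) simp_all
qed

text \<open>The arc starting at \<open>s\<close> misses the adjacent indices s + 3 and s + 4 modulo
  5, which form the kept pair of \<open>move5\<close>.\<close>

lemma scn_move_five: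
  "scn_move 3 [v, w, x, y, z] ys \<longleftrightarrow>
    (\<exists>v' w' x' y' z'. ys = filter (\<lambda>z. 0 < z) [v', w', x', y', z'] \<and>
       [v', w', x', y', z'] \<noteq> [v, w, x, y, z] \<and> move5 v w x y z v' w' x' y' z')"
  (is "_ \<longleftrightarrow> ?R")
proof
  have len: "length [v, w, x, y, z] = 5" by simp
  assume "scn_move 3 [v, w, x, y, z] ys"
  then obtain s zs where s: "s < 5" and zs: "length zs = 5" "zs \<noteq> [v, w, x, y, z]"
    "ys = filter (\<lambda>z. 0 < z) zs" and le: "\<forall>j<5. zs ! j \<le> [v, w, x, y, z] ! j"
    and keep: "\<forall>j<5. j \<notin> arc 5 3 s \<longrightarrow> zs ! j = [v, w, x, y, z] ! j"
    unfolding scn_move_def len by blast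
  obtain v' w' x' y' z' where zs_eq: "zs = [v', w', x', y', z']"
    using zs(1) unfolding length_eq_5 by blast
  have "v' \<le> v \<and> w' \<le> w \<and> x' \<le> x \<and> y' \<le> y \<and> z' \<le> z"
    using le unfolding less_5_iff zs_eq by simp
  moreover have "v' = v \<and> w' = w \<or> w' = w \<and> x' = x \<or> x' = x \<and> y' = y \<or> y' = y \<and> z' = z \<or> z' = z \<and> v' = v"
    using keep[rule_format, of "(s + 3) mod 5"] keep[rule_format, of "(s + 4) mod 5"] s
    unfolding zs_eq by (auto simp: arc_five less_5_iff)
  ultimately show ?R using zs zs_eq unfolding move5_def by blast
next
  have len: "length [v, w, x, y, z] = 5" by simp
  assume ?R
  then obtain v' w' x' y' z' where ys: "ys = filter (\<lambda>z. 0 < z) [v', w', x', y', z']"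
    and ne: "[v', w', x', y', z'] \<noteq> [v, w, x, y, z]" and mv: "move5 v w x y z v' w' x' y' z'"
    by blast
  let ?xs = "[v, w, x, y, z]" and ?zs = "[v', w', x', y', z']"
  have "\<exists>s\<in>{0, 1, 2, 3, 4}. ?zs ! ((s + 3) mod 5) = ?xs ! ((s + 3) mod 5) \<and>
      ?zs ! ((s + 4) mod 5) = ?xs ! ((s + 4) mod 5)"
    using mv by (simp add: move5_def) blast
  then obtain s where "s \<in> {0, 1, 2, 3, 4}" and s: "?zs ! ((s + 3) mod 5) = ?xs ! ((s + 3) mod 5)"
    "?zs ! ((s + 4) mod 5) = ?xs ! ((s + 4) mod 5)"
    by blast
  then have "s < 5" by auto
  have "\<forall>j<5. ?zs ! j \<le> ?xs ! j"
    using mv by (auto simp: less_5_iff move5_def)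
  moreover have "\<forall>j<5. j \<notin> arc 5 3 s \<longrightarrow> ?zs ! j = ?xs ! j"
    using s \<open>s < 5\<close> arc_five by blast
  ultimately show "scn_move 3 ?xs ys"
    unfolding scn_move_def len using \<open>s < 5\<close> ys ne
    by (intro exI[of _ s] exI[of _ ?zs] conjI) simp_all
qed

lemma scn_move_to_Nil:
  assumes "xs \<noteq> []" "length xs \<le> 3" "\<forall>x\<in>set xs. 0 < x"
  shows "scn_move 3 xs []"
proof -
  have "j \<in> arc (length xs) 3 0" if "j < length xs" for j
    unfolding arc_def using that assms(2) by (intro CollectI exI[of _ j]) auto
  moreover have "replicate (length xs) 0 \<noteq> xs"
    using assms by (cases xs) auto
  ultimately show ?thesis
    unfolding scn_move_def using assms(1)
    by (intro exI[of _ 0] exI[of _ "replicate (length xs) 0"]) auto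
qed

section \<open>The kernel as a set of lists\<close>

definition scn53_kernel :: "nat list set" where
  "scn53_kernel = {[]} \<union> {[a, a, a, a] | a. 0 < a} \<union>
     {[v, w, x, y, z] | v w x y z. 0 < v \<and> 0 < w \<and> 0 < x \<and> 0 < y \<and> 0 < z \<and> kernel5 v w x y z}"

text \<open>Only \<open>four\<close> contains a zero, and dropping it leaves four equal
  piles.\<close>

lemma kernel5_imp_filter_in_kernel:
  assumes "kernel5 v w x y z"
  shows "filter (\<lambda>z. 0 < z) [v, w, x, y, z] \<in> scn53_kernel"
proof (cases "0 < v \<and> 0 < w \<and> 0 < x \<and> 0 < y \<and> 0 < z")
  case True
  then show ?thesis using assms by (simp add: scn53_kernel_def)
next
  case False
  then have "dihedral5 four v w x y z"
    using assms
    unfolding kernel5_def dihedral5_def one_family_def two_family_def by auto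
  then have "\<exists>a>0. filter (\<lambda>z. 0 < z) [v, w, x, y, z] = [a, a, a, a]"
    unfolding dihedral5_def four_def by (elim disjE) simp_all
  then show ?thesis unfolding scn53_kernel_def by blast
qed

text \<open>The nonzero sum rules out the filtered list \<open>[]\<close>, which lies in
  \<open>scn53_kernel\<close> although five zeros do not satisfy \<open>kernel5\<close>.\<close>

lemma filter_in_kernel_imp_kernel5:
  assumes "filter (\<lambda>z. 0 < z) [v, w, x, y, z] \<in> scn53_kernel"
    and ne: "v + w + x + y + z \<noteq> 0"
  shows "kernel5 v w x y z"
proof (cases "0 < v \<and> 0 < w \<and> 0 < x \<and> 0 < y \<and> 0 < z")
  case True
  then show ?thesis using assms by (simp add: scn53_kernel_def)
next
  case False
  have "dihedral5 four v w x y z"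
    using assms False unfolding scn53_kernel_def dihedral5_def four_def
    by (cases v; cases w; cases x; cases y; cases z) simp_all
  then show ?thesis unfolding kernel5_def dihedral5_def by blast
qed

lemma scn53_kernel_stable:
  assumes xs: "xs \<in> scn53_kernel" and mv: "scn_move 3 xs ys"
  shows "ys \<notin> scn53_kernel"
proof
  assume ys: "ys \<in> scn53_kernel"
  consider "xs = []" | a where "0 < a" "xs = [a, a, a, a]"
    | v w x y z where "xs = [v, w, x, y, z]" "0 < v" "0 < w" "0 < x" "0 < y" "0 < z"
      "kernel5 v w x y z"
    using xs unfolding scn53_kernel_def by blast
  then show False
  proof cases
    case 1
    then show False using mv by (simp add: scn_move_def)
  next
    case 2
    obtain w x y z where ys_eq: "ys = filter (\<lambda>z. 0 < z) [w, x, y, z]"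
      and ne: "[w, x, y, z] \<noteq> [a, a, a, a]" and keep: "w = a \<or> x = a \<or> y = a \<or> z = a"
      using mv unfolding 2 scn_move_four by blast
    \<comment> \<open>The kept pile survives, so \<open>ys\<close> is a nonempty kernel list of at
      most four piles containing \<open>a\<close>; it must be \<open>[a, a, a, a]\<close>, so no
      stone was removed.\<close>
    have "a \<in> set ys" using keep \<open>0 < a\<close> unfolding ys_eq by auto
    moreover have "length ys \<le> 4"
      unfolding ys_eq by (rule order_trans[OF length_filter_le]) simp
    ultimately have "ys = [a, a, a, a]"
      using ys unfolding scn53_kernel_def by auto
    then show False
      using ne unfolding ys_eq by (auto split: if_splits)
  next
    case 3
    obtain v' w' x' y' z' where ys_eq: "ys = filter (\<lambda>z. 0 < z) [v', w', x', y', z']"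
      and ne: "[v', w', x', y', z'] \<noteq> [v, w, x, y, z]" and mv5: "move5 v w x y z v' w' x' y' z'"
      using mv unfolding 3 scn_move_five by blast
    have "v' + w' + x' + y' + z' \<noteq> 0"
      using mv5 3(2-6) unfolding move5_def by linarith
    then have "kernel5 v' w' x' y' z'"
      using ys filter_in_kernel_imp_kernel5 unfolding ys_eq by blast
    then show False
      using stable5_kernel5[OF 3(7,2-6)] mv5 ne unfolding stable5_def by blast
  qed
qed

lemma scn53_kernel_absorbing:
  assumes xs: "xs \<in> scn_configs 5" "xs \<notin> scn53_kernel"
  shows "\<exists>ys\<in>scn53_kernel. scn_move 3 xs ys"
proof -
  have len: "length xs \<le> 5" and pos: "\<forall>x\<in>set xs. 0 < x"
    using xs(1) by (auto simp: scn_configs_def)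
  have "xs \<noteq> []" using xs(2) by (auto simp: scn53_kernel_def)
  from len consider "length xs \<le> 3" | "length xs = 4" | "length xs = 5" by linarith
  then show ?thesis
  proof cases
    case 1
    then show ?thesis
      using scn_move_to_Nil[OF \<open>xs \<noteq> []\<close> _ pos] by (auto simp: scn53_kernel_def)
  next
    case 2
    then obtain w x y z where xs_eq: "xs = [w, x, y, z]" unfolding length_eq_4 by blast
    \<comment> \<open>A smallest pile stays untouched while the other three are lowered to its
      size.\<close>
    define m where "m = Min {w, x, y, z}"
    have "m \<in> {w, x, y, z}" unfolding m_def by (rule Min_in) auto
    moreover have "m \<le> w" "m \<le> x" "m \<le> y" "m \<le> z" unfolding m_def by (rule Min_le; simp)+
    moreover have "0 < m" using calculation(1) pos xs_eq by auto
    moreover have "[m, m, m, m] \<noteq> xs" using xs(2) \<open>0 < m\<close> by (auto simp: scn53_kernel_def)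
    ultimately have "scn_move 3 xs [m, m, m, m]"
      unfolding xs_eq scn_move_four
      by (intro exI[of _ m]) auto
    then show ?thesis using \<open>0 < m\<close> by (auto simp: scn53_kernel_def)
  next
    case 3
    then obtain v w x y z where xs_eq: "xs = [v, w, x, y, z]" unfolding length_eq_5 by blast
    then have "reach5 v w x y z" using pos by (intro reach5_pos) auto
    then obtain v' w' x' y' z' where mv: "move5 v w x y z v' w' x' y' z'"
      and ker: "kernel5 v' w' x' y' z'"
      unfolding reach5_def by blast
    \<comment> \<open>The null move allowed by \<open>move5\<close> cannot have occurred, since
      \<open>xs\<close> is outside the kernel.\<close>
    have "[v', w', x', y', z'] \<noteq> xs"
      using ker xs(2) pos unfolding xs_eq scn53_kernel_def by auto
    then show ?thesis
      using mv kernel5_imp_filter_in_kernel[OF ker] unfolding xs_eq scn_move_five by blast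
  qed
qed

lemma scn53_kernel_conv:
  "scn53_kernel = {xs. \<exists>ys. same_config xs ys \<and>
     (ys = [] \<or> (\<exists>a. 1 \<le> a \<and> ys = [a, a, a, a]) \<or>
      (\<exists>a b M. 1 \<le> a \<and> a < b \<and> b \<le> M \<and> 1 + M = a + b \<and> ys = [1, M, a, b, M]) \<or>
      (\<exists>p. 2 \<le> p \<and> ys = [2, 2 * p, p + 1, p, 2 * p - 1]))}"
  (is "_ = {xs. \<exists>ys. same_config xs ys \<and> (ys = [] \<or> ?four ys \<or> ?one ys \<or> ?two ys)}")
proof -
  have five: "?one ys \<or> ?two ys \<longleftrightarrow> (\<exists>a b c d e. ys = [a, b, c, d, e] \<and>
    (one_family a b c d e \<or> two_family a b c d e))" for ys
    unfolding one_family_def two_family_def by (rule iffI; elim disjE exE conjE; fastforce)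
  have "xs \<in> scn53_kernel \<longleftrightarrow> (\<exists>ys. same_config xs ys \<and> (ys = [] \<or> ?four ys \<or> ?one ys \<or> ?two ys))" for xs
  proof
    assume "xs \<in> scn53_kernel"
    then consider "xs = []" | a where "0 < a" "xs = [a, a, a, a]"
      | v w x y z where "xs = [v, w, x, y, z]" "0 < v" "0 < w" "0 < x" "0 < y" "0 < z"
        "kernel5 v w x y z"
      unfolding scn53_kernel_def by blast
    then show "\<exists>ys. same_config xs ys \<and> (ys = [] \<or> ?four ys \<or> ?one ys \<or> ?two ys)"
    proof cases
      case 3
      then have "dihedral5 (\<lambda>v w x y z. one_family v w x y z \<or> two_family v w x y z) v w x y z"
        unfolding kernel5_def dihedral5_def four_def by auto
      then have "\<exists>ys. same_config xs ys \<and> (?one ys \<or> ?two ys)"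
        unfolding five same_config5 3 .
      then show ?thesis by blast
    qed (use same_config_refl in force)+
  next
    assume "\<exists>ys. same_config xs ys \<and> (ys = [] \<or> ?four ys \<or> ?one ys \<or> ?two ys)"
    then obtain ys where ys: "same_config xs ys"
      and cases: "ys = [] \<or> ?four ys \<or> (?one ys \<or> ?two ys)" by blast
    have len: "length ys = length xs" and set: "set ys = set xs"
      using ys by (auto simp: same_config_def)
    from cases consider "ys = []" | a where "1 \<le> a" "ys = [a, a, a, a]" | "?one ys \<or> ?two ys"
      by blast
    then show "xs \<in> scn53_kernel"
    proof cases
      case 1
      then show ?thesis using len by (simp add: scn53_kernel_def)
    next
      case (2 a)
      \<comment> \<open>Rotation and reflection preserve length and set of entries, which determine
        a constant list.\<close>
      then have "xs = replicate 4 a"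
        using len set by (intro replicate_eqI) auto
      then show ?thesis using 2 by (simp add: scn53_kernel_def eval_nat_numeral)
    next
      case 3
      then have "length xs = 5" and pos: "\<forall>x\<in>set xs. 0 < x"
        unfolding len[symmetric] set[symmetric] by auto
      then obtain v w x y z where xs: "xs = [v, w, x, y, z]" unfolding length_eq_5 by blast
      have "dihedral5 (\<lambda>v w x y z. one_family v w x y z \<or> two_family v w x y z) v w x y z"
        using ys 3 unfolding xs five same_config5[symmetric] by blast
      then have "kernel5 v w x y z" unfolding kernel5_def dihedral5_def by blast
      then show ?thesis using pos unfolding xs scn53_kernel_def by auto
    qed
  qed
  then show ?thesis by (intro set_eqI) (simp only: mem_Collect_eq)
qed

theorem theorem3p4:
  "scn_P_positions 5 3 =
     {xs. \<exists>ys. same_config xs ys \<and>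
        (ys = [] \<or>
         (\<exists>a. 1 \<le> a \<and> ys = [a, a, a, a]) \<or>
         (\<exists>a b M. 1 \<le> a \<and> a < b \<and> b \<le> M \<and> 1 + M = a + b \<and> ys = [1, M, a, b, M]) \<or>
         (\<exists>p. 2 \<le> p \<and> ys = [2, 2 * p, p + 1, p, 2 * p - 1]))}"
proof -
  have "scn53_kernel \<subseteq> scn_configs 5"
    by (auto simp: scn53_kernel_def scn_configs_def)
  then show ?thesis
    unfolding scn53_kernel_conv[symmetric]
    using scn53_kernel_stable scn53_kernel_absorbing by (rule scn_P_positions_kernel)
qed

end
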